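(* Let $p>2$, $\sigma>0$, $c\in\mathbb{R}^n$, let $H\in\mathbb{R}^{n\times n}$ be symmetric and let $A\in\mathbb{R}^{n\times n}$ be symmetric positive definite. Consider the problem $$\min_{x\in\mathbb{R}^n} h(x)=c^Tx+\tfrac12 x^THx+\tfrac{\sigma}{p}\|x\|_A^p .$$ Let $\mu_1\le\dots\le\mu_n$ be the eigenvalues of $A^{-1/2}HA^{-1/2}$, let $V\in\mathbb{R}^{n\times n}$ be an orthogonal matrix with $V^T(A^{-1/2}HA^{-1/2})V=\mathrm{diag}(\mu_1,\dots,\mu_n)$, and let $\beta=V^TA^{-1/2}c$, with components $\beta_i$. Then a point $x^*$ is a global minimizer of $h$ over $\mathbb{R}^n$ if and only if $$\left(H+\sigma (z^* )^{p-2}A\right)x^*=-c,\qquad H+\sigma (z^* )^{p-2}A\succeq 0,$$ where $z^*$ is the unique non-negative root of the equation $$z^2=\sum_{i=1}^n\frac{\beta_i^2}{(\mu_i+\sigma z^{p-2})^2}.$$ Moreover, the $\|\cdot\|_A$ norms of all the global minimizers are equal.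
   Context: For a symmetric positive definite matrix $A$, $\|x\|_A=\sqrt{x^TAx}$. $M\succeq0$ means that the symmetric matrix $M$ is positive semidefinite. $A^{1/2}$ is the symmetric positive definite square root of $A$ and $A^{-1/2}$ its inverse.
   Formalization: The root z* is taken among z≥0 with all μ_i+σz^{p-2}≥0 (otherwise it need not be unique); a 0/0 term in the sum may take any non-negative value, a nonzero/0 term excludes z; if some μ_i+σ(z* )^{p-2}=0, the condition ‖x*‖_A=z* is added, without which "if" fails. *)

theory Defs
  imports "HOL-Analysis.Analysis"
begin

definition pos_semidef :: "real^'n^'n \<Rightarrow> bool" where
  "pos_semidef M \<longleftrightarrow> transpose M = M \<and> (\<forall>x. 0 \<le> x \<bullet> (M *v x))"

definition pos_def :: "real^'n^'n \<Rightarrow> bool" where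
  "pos_def M \<longleftrightarrow> transpose M = M \<and> (\<forall>x. x \<noteq> 0 \<longrightarrow> 0 < x \<bullet> (M *v x))"

definition mat_sqrt :: "real^'n^'n \<Rightarrow> real^'n^'n" where
  "mat_sqrt A = (THE S. pos_def S \<and> S ** S = A)"

definition diag_mat :: "real^'n \<Rightarrow> real^'n^'n" where
  "diag_mat d = (\<chi> i j. if i = j then d $ i else 0)"

definition norm_wrt :: "real^'n^'n \<Rightarrow> real^'n \<Rightarrow> real" where
  "norm_wrt A x = sqrt (x \<bullet> (A *v x))"

definition preg_obj ::
  "real \<Rightarrow> real \<Rightarrow> real^'n \<Rightarrow> real^'n^'n \<Rightarrow> real^'n^'n \<Rightarrow> real^'n \<Rightarrow> real" where
  "preg_obj p \<sigma> c H A x =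
     c \<bullet> x + 1/2 * (x \<bullet> (H *v x)) + \<sigma> / p * norm_wrt A x powr p"

definition global_minimizer :: "('a \<Rightarrow> real) \<Rightarrow> 'a \<Rightarrow> bool" where
  "global_minimizer f x \<longleftrightarrow> (\<forall>y. f x \<le> f y)"

(* The equation z^2 = (sum over i of beta_i^2 / (mu_i + sigma z^(p-2))^2).  If no denominator
   vanishes at z, this is literally that equation.  If some denominator does vanish, then a summand
   a/0 with a nonzero has no value, and a summand 0/0 is allowed to take any non-negative value.
   (The i-th summand is the square of the i-th coordinate y_i of V^T A^(1/2) x, which is subject
   to (mu_i + sigma z^(p-2)) y_i = - beta_i and is therefore free in the 0/0 case.)  The right-hand
   side then ranges over all numbers from the sum of the remaining summands upwards; since 0/0 = 0
   in HOL, that lower bound is the sum over all i as written. *)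
definition secular_eq :: "real \<Rightarrow> real \<Rightarrow> real^'n \<Rightarrow> real^'n \<Rightarrow> real \<Rightarrow> bool" where
  "secular_eq p \<sigma> \<mu> \<beta> z \<longleftrightarrow>
     (if \<forall>i. \<mu> $ i + \<sigma> * z powr (p - 2) \<noteq> 0
      then z\<^sup>2 = (\<Sum>i\<in>UNIV. (\<beta> $ i)\<^sup>2 / (\<mu> $ i + \<sigma> * z powr (p - 2))\<^sup>2)
      else (\<forall>i. \<mu> $ i + \<sigma> * z powr (p - 2) = 0 \<longrightarrow> \<beta> $ i = 0) \<and>
           (\<Sum>i\<in>UNIV. (\<beta> $ i)\<^sup>2 / (\<mu> $ i + \<sigma> * z powr (p - 2))\<^sup>2) \<le> z\<^sup>2)"

(* Non-negative roots are taken in the range where every mu_i + sigma z^(p-2) is non-negative: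
   when some mu_i is negative there can be further non-negative roots outside this range.
   The restriction is vacuous when all mu_i are non-negative. *)
definition secular_root :: "real \<Rightarrow> real \<Rightarrow> real^'n \<Rightarrow> real^'n \<Rightarrow> real \<Rightarrow> bool" where
  "secular_root p \<sigma> \<mu> \<beta> z \<longleftrightarrow>
     0 \<le> z \<and> (\<forall>i. 0 \<le> \<mu> $ i + \<sigma> * z powr (p - 2)) \<and> secular_eq p \<sigma> \<mu> \<beta> z"

end

theory Submission
  imports Defs
begin

text \<open>
  With \<open>P = V\<^sup>T A\<^sup>1\<^sup>/\<^sup>2\<close> we have \<open>A = P\<^sup>T P\<close>, \<open>H = P\<^sup>T diag(\<mu>) P\<close> and \<open>c = P\<^sup>T \<beta>\<close>, so \<open>y = P x\<close> turns
  the problem into a diagonal one with the Euclidean norm. If \<open>(\<mu>\<^sub>i + w) y\<^sub>i = - \<beta>\<^sub>i\<close> for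
  \<open>w = \<sigma> |y|\<^sup>p\<^sup>-\<^sup>2\<close>, the excess of the objective at \<open>y'\<close> over \<open>y\<close> is the quadratic form of
  \<open>diag(\<mu>) + w\<close> at \<open>y' - y\<close>, halved, plus a convexity gap of \<open>t \<mapsto> t\<^sup>p\<^sup>/\<^sup>2\<close> that vanishes
  only for \<open>|y'| = |y|\<close>. A root \<open>z\<close> of the secular equation yields such a \<open>y\<close> with
  \<open>|y| = z\<close>, hence a minimizer, and the excess vanishes exactly at the points claimed. All minimizers
  then have norm \<open>z\<close>, which also makes the root unique; its existence is the intermediate value
  theorem.
\<close>

section \<open>Self-adjoint maps and square roots\<close>

text \<open>Along the line \<open>x + t *\<^sub>R u\<close> the form equals
  \<open>2 * t * a + t\<^sup>2 * b\<close>; if \<open>a\<close> were nonzero, the linear term would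
  win for small \<open>t\<close> and make the form negative inside \<open>W\<close>.\<close>

lemma nonneg_form_null:
  fixes f :: "'a::real_inner \<Rightarrow> 'a"
  assumes f: "linear f" and adj: "\<And>x y. f x \<bullet> y = x \<bullet> f y"
    and W: "subspace W" and nonneg: "\<And>x. x \<in> W \<Longrightarrow> 0 \<le> x \<bullet> f x"
    and x: "x \<in> W" "x \<bullet> f x = 0" and u: "u \<in> W"
  shows "u \<bullet> f x = 0"
proof (rule ccontr)
  define a b where "a = u \<bullet> f x" and "b = u \<bullet> f u"
  assume "u \<bullet> f x \<noteq> 0"
  then have a: "a \<noteq> 0" by (simp add: a_def)
  have b: "0 \<le> b" using nonneg u by (simp add: b_def)
  \<comment> \<open>The minimizing step would be - a / b; the denominator \<open>b + 1\<close> also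
    covers \<open>b = 0\<close> and still gives a negative value.\<close>
  define t where "t = - a / (b + 1)"
  have "x + t *\<^sub>R u \<in> W" using W x u by (simp add: subspace_add subspace_scale)
  then have "0 \<le> (x + t *\<^sub>R u) \<bullet> f (x + t *\<^sub>R u)" by (rule nonneg)
  also have "\<dots> = 2 * t * a + t\<^sup>2 * b"
    using x(2) adj[of x u]
    by (simp add: linear_add[OF f] linear_scale[OF f] inner_add_left inner_add_right a_def b_def
        inner_commute power2_eq_square algebra_simps)
  also have "\<dots> = - (a\<^sup>2 * (b + 2)) / (b + 1)\<^sup>2"
  proof -
    have "t * (b + 1) = - a" using b by (simp add: t_def)
    then have "a = - (t * (b + 1))" by simp
    then have "(2 * t * a + t\<^sup>2 * b) * (b + 1)\<^sup>2 = - (a\<^sup>2 * (b + 2))" by algebra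
    moreover have "(b + 1)\<^sup>2 \<noteq> 0" using b by simp
    ultimately show ?thesis by (metis nonzero_eq_divide_eq)
  qed
  also have "\<dots> < 0" using a b by (simp add: divide_neg_pos)
  finally show False by simp
qed

text \<open>A maximizer \<open>v\<close> of the form on the unit sphere of \<open>W\<close>, with
  maximum \<open>l\<close>, is an eigenvector: the form of \<open>g = l - f\<close> is non-negative
  on \<open>W\<close> and vanishes at \<open>v\<close>, so \<open>g v\<close> is orthogonal to
  \<open>W\<close>. As \<open>g v\<close> lies in \<open>W\<close>, it is zero.\<close>

lemma self_adjoint_eigenvector:
  fixes f :: "'a::euclidean_space \<Rightarrow> 'a"
  assumes f: "linear f" and adj: "\<And>x y. f x \<bullet> y = x \<bullet> f y"
    and W: "subspace W" "f ` W \<subseteq> W" "W \<noteq> {0}"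
  obtains v l where "v \<in> W" "norm v = 1" "f v = l *\<^sub>R v"
proof -
  let ?K = "sphere 0 1 \<inter> W"
  obtain w where w: "w \<in> W" "w \<noteq> 0" using W(1,3) subspace_0 by blast
  then have "w /\<^sub>R norm w \<in> ?K" using W(1) by (simp add: subspace_scale)
  then have "?K \<noteq> {}" by blast
  moreover have "compact ?K" using closed_subspace[OF W(1)] by (simp add: compact_Int_closed)
  moreover have "continuous_on ?K (\<lambda>x. x \<bullet> f x)"
    using f by (intro continuous_intros linear_continuous_on linear_conv_bounded_linear[THEN iffD1])
  ultimately obtain v where v: "v \<in> ?K" and max: "\<And>x. x \<in> ?K \<Longrightarrow> x \<bullet> f x \<le> v \<bullet> f v"
    using continuous_attains_sup[of ?K "\<lambda>x. x \<bullet> f x"] by metis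
  define l where "l = v \<bullet> f v"
  define g where "g x = l *\<^sub>R x - f x" for x
  have g: "linear g" unfolding g_def
    using f by (intro linear_compose_sub linear_scale_self)
  have gadj: "g x \<bullet> y = x \<bullet> g y" for x y
    by (simp add: g_def inner_diff_left inner_diff_right adj)
  have pos: "0 \<le> x \<bullet> g x" if "x \<in> W" for x
  proof (cases "x = 0")
    case False
    let ?x = "x /\<^sub>R norm x"
    have "?x \<in> ?K" using that W(1) False by (simp add: subspace_scale)
    then have "?x \<bullet> f ?x \<le> l" unfolding l_def by (rule max)
    moreover have "?x \<bullet> f ?x = (x \<bullet> f x) / (norm x)\<^sup>2"
      by (simp add: linear_scale[OF f] power2_eq_square field_simps)
    ultimately have "(x \<bullet> f x) / (norm x)\<^sup>2 \<le> l" by simp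
    then have "x \<bullet> f x \<le> l * (norm x)\<^sup>2" using False by (simp add: divide_le_eq)
    then show ?thesis by (simp add: g_def inner_diff_right power2_norm_eq_inner)
  qed simp
  have nv: "norm v = 1" "v \<in> W" using v by auto
  then have "v \<bullet> v = 1" by (simp add: norm_eq_sqrt_inner)
  then have "v \<bullet> g v = 0" by (simp add: g_def inner_diff_right l_def)
  moreover have "g v \<in> W"
    using W nv by (auto simp: g_def intro: subspace_diff subspace_scale)
  ultimately have "g v \<bullet> g v = 0"
    using nonneg_form_null[OF g gadj W(1) pos nv(2)] by blast
  then have "f v = l *\<^sub>R v" by (simp add: g_def)
  with nv that show thesis by blast
qed

text \<open>Induction on the dimension: split off a unit eigenvector \<open>v\<close>.
  Self-adjointness makes its orthogonal complement \<open>U\<close> in \<open>W\<close> invariant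
  again, which is why an arbitrary invariant subspace is treated.\<close>

lemma self_adjoint_eigenbasis:
  fixes f :: "'a::euclidean_space \<Rightarrow> 'a"
  assumes f: "linear f" and adj: "\<And>x y. f x \<bullet> y = x \<bullet> f y"
    and "subspace W" "f ` W \<subseteq> W"
  shows "\<exists>B. finite B \<and> span B = W \<and> (\<forall>a\<in>B. \<forall>b\<in>B. a \<bullet> b = (if a = b then 1 else 0)) \<and>
             (\<forall>b\<in>B. \<exists>l. f b = l *\<^sub>R b)"
  using assms(3,4)
proof (induction "dim W" arbitrary: W rule: less_induct)
  case less
  show ?case
  proof (cases "W = {0}")
    case True
    then show ?thesis by (intro exI[of _ "{}"]) auto
  next
    case False
    obtain v l where v: "v \<in> W" "norm v = 1" "f v = l *\<^sub>R v"
      using self_adjoint_eigenvector[OF f adj less.prems False] by blast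
    have vv: "v \<bullet> v = 1" using v by (simp add: norm_eq_sqrt_inner)
    define U where "U = W \<inter> {x. v \<bullet> x = 0}"
    have U: "subspace U"
      unfolding U_def using less.prems(1) subspace_hyperplane by (rule subspace_inter)
    have fU: "f ` U \<subseteq> U"
    proof
      fix y assume "y \<in> f ` U"
      then obtain x where x: "x \<in> U" "y = f x" by blast
      have "v \<bullet> f x = 0" using adj[of v x] v x by (simp add: U_def)
      then show "y \<in> U" using x less.prems by (auto simp: U_def)
    qed
    have "v \<notin> U" using vv by (simp add: U_def)
    moreover have "U \<subseteq> W" by (auto simp: U_def)
    ultimately have "U \<subset> W" using v by blast
    then have "dim U < dim W"
      using U less.prems(1) by (metis dim_psubset span_eq_iff)
    from less.hyps[OF this U fU] obtain B where B: "finite B" "span B = U"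
      "\<forall>a\<in>B. \<forall>b\<in>B. a \<bullet> b = (if a = b then 1 else 0)" "\<forall>b\<in>B. \<exists>l. f b = l *\<^sub>R b" by blast
    have BU: "B \<subseteq> U" using B(2) span_superset by blast
    have "span (insert v B) = W"
    proof
      show "span (insert v B) \<subseteq> W"
        using BU v less.prems(1) by (intro span_minimal) (auto simp: U_def)
      show "W \<subseteq> span (insert v B)"
      proof
        fix x assume x: "x \<in> W"
        have "x - (v \<bullet> x) *\<^sub>R v \<in> U"
          using x v vv less.prems(1) by (auto simp: U_def inner_diff_right intro!: subspace_diff subspace_scale)
        then have "x - (v \<bullet> x) *\<^sub>R v \<in> span B" using B by simp
        then show "x \<in> span (insert v B)" by (auto simp: span_insert)
      qed
    qed
    moreover have "\<forall>a\<in>insert v B. \<forall>b\<in>insert v B. a \<bullet> b = (if a = b then 1 else 0)"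
      using B(3) BU vv by (auto simp: U_def inner_commute)
    ultimately show ?thesis using B v by (intro exI[of _ "insert v B"]) auto
  qed
qed

section \<open>Square roots of positive definite matrices\<close>

lemma symmetric_matrix_inner:
  fixes A :: "real^'n^'n"
  assumes "transpose A = A"
  shows "(A *v x) \<bullet> y = x \<bullet> (A *v y)"
  by (metis assms dot_lmul_matrix vector_transpose_matrix)

lemma matrix_eq_transposeI:
  fixes A :: "real^'n^'n"
  assumes "\<And>x y. (A *v x) \<bullet> y = x \<bullet> (A *v y)"
  shows "transpose A = A"
proof -
  have "transpose A *v x = A *v x" for x
  proof -
    have "(transpose A *v x) \<bullet> y = (A *v x) \<bullet> y" for y
      using assms[of x y] by (simp add: dot_lmul_matrix)
    then show ?thesis by (metis vector_eq_rdot)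
  qed
  then show ?thesis by (simp add: matrix_eq)
qed

lemma pos_def_sqrt_exists:
  fixes A :: "real^'n^'n"
  assumes A: "pos_def A"
  shows "\<exists>S. pos_def S \<and> S ** S = A"
proof -
  have sym: "transpose A = A" and pos: "\<And>x. x \<noteq> 0 \<Longrightarrow> 0 < x \<bullet> (A *v x)"
    using A by (auto simp: pos_def_def)
  obtain B where B: "finite B" "span B = UNIV"
    "\<forall>a\<in>B. \<forall>b\<in>B. a \<bullet> b = (if a = b then 1 else 0)" "\<forall>b\<in>B. \<exists>l. A *v b = l *\<^sub>R b"
    using self_adjoint_eigenbasis[of "(*v) A" UNIV] symmetric_matrix_inner[OF sym]
    by (auto simp: matrix_vector_mul_linear)
  \<comment> \<open>For a unit eigenvector \<open>b\<close>, the form at \<open>b\<close> is its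
    eigenvalue. So \<open>f\<close> below scales each basis vector by the root of its
    eigenvalue.\<close>
  define r where "r b = sqrt (b \<bullet> (A *v b))" for b
  define f where "f x = (\<Sum>b\<in>B. (r b * (b \<bullet> x)) *\<^sub>R b)" for x
  have f: "linear f"
    unfolding f_def
    by (intro linear_compose_sum ballI linearI)
      (simp_all add: inner_add_right algebra_simps)
  have bb: "b \<bullet> b = 1" if "b \<in> B" for b using B(3) that by simp
  have r: "0 < r b" if "b \<in> B" for b
  proof -
    have "b \<noteq> 0" using bb[OF that] by auto
    then show ?thesis using pos[of b] by (simp add: r_def)
  qed
  have fb: "f b = r b *\<^sub>R b" if "b \<in> B" for b
  proof -
    have "f b = (\<Sum>a\<in>B. if a = b then r b *\<^sub>R b else 0)"
      unfolding f_def using B(3) that by (intro sum.cong) auto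
    then show ?thesis using B(1) that by simp
  qed
  have Ab: "A *v b = (r b)\<^sup>2 *\<^sub>R b" if b: "b \<in> B" for b
  proof -
    obtain l where l: "A *v b = l *\<^sub>R b" using bspec[OF B(4) b] by (rule exE)
    moreover have "0 < b \<bullet> (A *v b)" using r[OF that] by (simp add: r_def)
    ultimately show ?thesis using bb[OF that] by (simp add: r_def)
  qed
  have ff: "f (f x) = A *v x" for x
  proof (rule linear_eq_on[of "\<lambda>x. f (f x)" "(*v) A" x B])
    show "linear (\<lambda>x. f (f x))" using linear_compose[OF f f] by (simp add: o_def)
    show "linear ((*v) A)" by (rule matrix_vector_mul_linear)
    show "x \<in> span B" using B(2) by simp
    show "f (f b) = A *v b" if "b \<in> B" for b
      using fb[OF that] Ab[OF that] by (simp add: linear_scale[OF f] power2_eq_square)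
  qed
  define S where "S = matrix f"
  have S: "S *v x = f x" for x by (simp add: S_def matrix_works f)
  have "S ** S = A"
    by (simp add: matrix_eq matrix_vector_mul_assoc[symmetric] S ff)
  moreover have "transpose S = S"
    by (rule matrix_eq_transposeI)
      (simp add: S f_def inner_sum_left inner_sum_right inner_commute mult.commute mult.left_commute)
  moreover have "0 < x \<bullet> (S *v x)" if "x \<noteq> 0" for x
  proof -
    have eq: "x \<bullet> (S *v x) = (\<Sum>b\<in>B. r b * (b \<bullet> x)\<^sup>2)"
      by (simp add: S f_def inner_sum_right inner_commute power2_eq_square mult.assoc)
    have "\<exists>b\<in>B. b \<bullet> x \<noteq> 0"
    proof (rule ccontr)
      assume "\<not> (\<exists>b\<in>B. b \<bullet> x \<noteq> 0)"
      then have "orthogonal x y" if "y \<in> span B" for y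
        using that by (intro orthogonal_to_span[of y B x]) (auto simp: orthogonal_def inner_commute)
      then have "orthogonal x x" using B(2) by simp
      then show False using \<open>x \<noteq> 0\<close> by (simp add: orthogonal_def)
    qed
    then obtain b where b: "b \<in> B" "b \<bullet> x \<noteq> 0" by blast
    show ?thesis unfolding eq
      using b r by (intro sum_pos2[OF B(1) b(1)]) (auto simp: less_imp_le)
  qed
  ultimately show ?thesis unfolding pos_def_def by blast
qed

text \<open>With \<open>D = S - T\<close>, the sum \<open>S ** D + D ** T\<close> telescopes to
  \<open>S ** S - T ** T = 0\<close>. Multiplying by \<open>D\<close> and taking the trace,
  cyclicity and symmetry of \<open>D\<close> leave two traces, each a sum of positive definite forms
  over the columns of \<open>D\<close>. Hence both vanish, and so does every column.\<close>

lemma pos_def_sqrt_unique: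
  fixes S T :: "real^'n^'n"
  assumes S: "pos_def S" and T: "pos_def T" and eq: "S ** S = T ** T"
  shows "S = T"
proof -
  have sym: "transpose S = S" "transpose T = T" using S T by (auto simp: pos_def_def)
  define D where "D = S - T"
  have D: "transpose D = D"
    using sym by (simp add: D_def transpose_def vec_eq_iff)
  have nonneg: "0 \<le> x \<bullet> (M *v x)" if "pos_def M" for M :: "real^'n^'n" and x
    using that by (cases "x = 0") (auto simp: pos_def_def less_imp_le)
  have "S ** D + D ** T = 0"
    using eq by (simp add: D_def matrix_matrix_mult_def vec_eq_iff algebra_simps sum_subtractf)
  have "trace (transpose D ** S ** D) + trace (transpose D ** T ** D) = trace (D ** (S ** D)) + trace (D ** (D ** T))"
    by (metis D matrix_mul_assoc trace_mul_sym)
  also have "\<dots> = trace (D ** (S ** D + D ** T))"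
    by (simp add: matrix_add_ldistrib trace_add)
  also have "\<dots> = 0" using \<open>S ** D + D ** T = 0\<close> by (simp add: trace_def matrix_matrix_mult_def)
  finally have tr: "trace (transpose D ** S ** D) + trace (transpose D ** T ** D) = 0" .
  have tr_eq: "trace (transpose D ** M ** D) = (\<Sum>i\<in>UNIV. column i D \<bullet> (M *v column i D))"
    for M :: "real^'n^'n"
    by (simp add: trace_def matrix_matrix_mult_def matrix_mult_dot inner_vec_def column_def
        transpose_def matrix_vector_mult_def sum_distrib_left sum_distrib_right mult.assoc)
      (intro sum.cong refl sum.swap)
  have "0 \<le> (\<Sum>i\<in>UNIV. column i D \<bullet> (M *v column i D))" if "pos_def M" for M :: "real^'n^'n"
    using nonneg[OF that] by (simp add: sum_nonneg)
  then have "(\<Sum>i\<in>UNIV. column i D \<bullet> (S *v column i D)) = 0"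
    using tr S T unfolding tr_eq by (meson add_nonneg_eq_0_iff)
  then have "column i D \<bullet> (S *v column i D) = 0" for i
    using nonneg[OF S] by (subst (asm) sum_nonneg_eq_0_iff) auto
  then have "column i D = 0" for i using S by (force simp: pos_def_def)
  then have "D = 0" by (simp add: column_def vec_eq_iff)
  then show ?thesis by (simp add: D_def)
qed

lemma mat_sqrt:
  assumes "pos_def A"
  shows pos_def_mat_sqrt: "pos_def (mat_sqrt A)"
    and mat_sqrt_mult_self: "mat_sqrt A ** mat_sqrt A = A"
proof -
  have "\<exists>!S. pos_def S \<and> S ** S = A"
    using pos_def_sqrt_exists[OF assms] pos_def_sqrt_unique by blast
  from theI'[OF this] show "pos_def (mat_sqrt A)" "mat_sqrt A ** mat_sqrt A = A"
    by (auto simp: mat_sqrt_def)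
qed

lemma invertible_pos_def:
  fixes S :: "real^'n^'n"
  assumes "pos_def S"
  shows "invertible S"
proof -
  have "x = 0" if "S *v x = 0" for x
    using assms that by (metis inner_zero_right less_irrefl pos_def_def)
  then show ?thesis
    by (simp add: invertible_left_inverse matrix_left_invertible_ker)
qed

section \<open>The diagonal problem\<close>

text \<open>This is the strict tangent inequality for the convex function u powr (p/2) / p at u =
  t^2, evaluated at u = s^2. In the proof, the derivative of \<open>F\<close> changes sign from
  negative to positive at \<open>t\<close>, so \<open>t\<close> is the strict minimizer of
  \<open>F\<close> on the half-line.\<close>

lemma powr_tangent_less:
  fixes p s t :: real
  assumes p: "2 < p" and "0 \<le> s" "0 \<le> t" "s \<noteq> t"
  shows "t powr (p - 2) / 2 * (s\<^sup>2 - t\<^sup>2) < (s powr p - t powr p) / p"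
proof -
  define F where "F x = x powr p / p - t powr (p - 2) / 2 * x\<^sup>2" for x
  have der: "(F has_real_derivative x * (x powr (p - 2) - t powr (p - 2))) (at x)" if "0 < x" for x
  proof -
    have "x powr (p - 1) = x * x powr (p - 2)"
      using that powr_add[of x 1 "p - 2"] by simp
    then show ?thesis unfolding F_def using p that
      by (auto intro!: derivative_eq_intros simp: algebra_simps)
  qed
  have cont: "continuous_on {a..b} F" if "0 \<le> a" for a b
    unfolding F_def using that p by (intro continuous_intros continuous_on_powr') auto
  have "F t < F s"
  proof (cases "t < s")
    case True
    show ?thesis
    \<comment> \<open>The left endpoint may be 0, where \<open>der\<close> says nothing; derivatives
      in the open interval and continuity on the closed one suffice.\<close>
    proof (rule DERIV_pos_imp_increasing_open[OF True])
      fix x assume x: "t < x" "x < s"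
      then have "0 < x * (x powr (p - 2) - t powr (p - 2))"
        using assms by (simp add: powr_less_mono2)
      then show "\<exists>y. DERIV F x :> y \<and> 0 < y" using der[of x] x assms by auto
    qed (use cont assms in auto)
  next
    case False
    then have "s < t" using assms by simp
    then show ?thesis
    proof (rule DERIV_neg_imp_decreasing_open)
      fix x assume x: "s < x" "x < t"
      then have "x * (x powr (p - 2) - t powr (p - 2)) < 0"
        using assms by (simp add: powr_less_mono2 mult_pos_neg)
      then show "\<exists>y. DERIV F x :> y \<and> y < 0" using der[of x] x assms by auto
    qed (use cont assms in auto)
  qed
  then show ?thesis by (simp add: F_def algebra_simps diff_divide_distrib)
qed

definition diag_obj :: "real \<Rightarrow> real \<Rightarrow> real^'n \<Rightarrow> real^'n \<Rightarrow> real^'n \<Rightarrow> real" where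
  "diag_obj p \<sigma> \<mu> \<beta> y =
     \<beta> \<bullet> y + 1/2 * (\<Sum>i\<in>UNIV. \<mu> $ i * (y $ i)\<^sup>2) + \<sigma> / p * norm y powr p"

lemma norm_vec_sq: "(norm (y :: real^'n))\<^sup>2 = (\<Sum>i\<in>UNIV. (y $ i)\<^sup>2)"
  unfolding power2_norm_eq_inner by (simp add: inner_vec_def power2_eq_square)

text \<open>Pure algebra, coordinate by coordinate: stationarity eliminates \<beta>, and adding and
  subtracting the quadratic with weight \<open>w\<close> completes the square. No relation between
  \<open>w\<close> and the norm of \<open>y\<close> enters yet.\<close>

lemma diag_obj_gap:
  fixes y y' :: "real^'n"
  assumes "\<And>i. (\<mu> $ i + w) * y $ i = - \<beta> $ i"
  shows "diag_obj p \<sigma> \<mu> \<beta> y' - diag_obj p \<sigma> \<mu> \<beta> y =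
    1/2 * (\<Sum>i\<in>UNIV. (\<mu> $ i + w) * (y' $ i - y $ i)\<^sup>2) +
    (\<sigma> / p * (norm y' powr p - norm y powr p) - w / 2 * ((norm y')\<^sup>2 - (norm y)\<^sup>2))"
proof -
  have "\<beta> $ i * y' $ i + 1/2 * (\<mu> $ i * (y' $ i)\<^sup>2) - (\<beta> $ i * y $ i + 1/2 * (\<mu> $ i * (y $ i)\<^sup>2)) =
    1/2 * ((\<mu> $ i + w) * (y' $ i - y $ i)\<^sup>2) - w / 2 * ((y' $ i)\<^sup>2 - (y $ i)\<^sup>2)" for i
  proof -
    have \<beta>: "\<beta> $ i = - ((\<mu> $ i + w) * y $ i)" using assms[of i] by simp
    show ?thesis unfolding \<beta> by (simp add: power2_eq_square field_simps)
  qed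
  then have "(\<Sum>i\<in>UNIV. \<beta> $ i * y' $ i + 1/2 * (\<mu> $ i * (y' $ i)\<^sup>2) - (\<beta> $ i * y $ i + 1/2 * (\<mu> $ i * (y $ i)\<^sup>2))) =
    (\<Sum>i\<in>UNIV. 1/2 * ((\<mu> $ i + w) * (y' $ i - y $ i)\<^sup>2) - w / 2 * ((y' $ i)\<^sup>2 - (y $ i)\<^sup>2))"
    by simp
  then show ?thesis
    unfolding diag_obj_def norm_vec_sq
    by (simp add: inner_vec_def sum.distrib sum_subtractf sum_distrib_left[symmetric] right_diff_distrib
        flip: sum_divide_distrib)
qed

lemma diag_minimizer_iff:
  fixes y :: "real^'n"
  assumes p: "2 < p" "0 < \<sigma>" and w: "w = \<sigma> * norm y powr (p - 2)"
    and stat: "\<And>i. (\<mu> $ i + w) * y $ i = - \<beta> $ i" and psd: "\<And>i. 0 \<le> \<mu> $ i + w"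
  shows "global_minimizer (diag_obj p \<sigma> \<mu> \<beta>) x \<longleftrightarrow>
    (\<forall>i. (\<mu> $ i + w) * x $ i = - \<beta> $ i) \<and> norm x = norm y"
proof -
  let ?g = "diag_obj p \<sigma> \<mu> \<beta>"
  let ?q = "\<lambda>x. \<Sum>i\<in>UNIV. (\<mu> $ i + w) * (x $ i - y $ i)\<^sup>2"
  let ?r = "\<lambda>x. \<sigma> / p * (norm x powr p - norm y powr p) - w / 2 * ((norm x)\<^sup>2 - (norm y)\<^sup>2)"
  have gap: "?g x - ?g y = 1/2 * ?q x + ?r x" for x by (rule diag_obj_gap[OF stat])
  have q: "0 \<le> ?q x" for x using psd by (intro sum_nonneg) simp
  have r: "0 < ?r x" if "norm x \<noteq> norm y" for x
    using mult_strict_left_mono[OF powr_tangent_less[OF p(1) norm_ge_zero norm_ge_zero that] p(2)]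
    by (simp add: w mult.assoc)
  have r0: "0 \<le> ?r x" for x using r[of x] by (cases "norm x = norm y") auto
  have min_y: "?g y \<le> ?g x" for x using gap[of x] q[of x] r0[of x] by linarith
  have "global_minimizer ?g x \<longleftrightarrow> ?g x \<le> ?g y"
    unfolding global_minimizer_def using min_y order_trans by blast
  also have "\<dots> \<longleftrightarrow> ?q x = 0 \<and> ?r x = 0"
    using gap[of x] q[of x] r0[of x] by linarith
  also have "?r x = 0 \<longleftrightarrow> norm x = norm y" using r[of x] by (cases "norm x = norm y") auto
  also have "?q x = 0 \<longleftrightarrow> (\<forall>i. (\<mu> $ i + w) * (x $ i - y $ i)\<^sup>2 = 0)"
    using psd by (subst sum_nonneg_eq_0_iff) auto
  \<comment> \<open>Since \<open>y\<close> solves the linear system, \<open>x\<close> solves it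
    exactly when \<open>x - y\<close> is supported on the coordinates with \<mu>_i + w = 0.\<close>
  also have "\<dots> \<longleftrightarrow> (\<forall>i. (\<mu> $ i + w) * x $ i = - \<beta> $ i)"
    unfolding stat[symmetric] by auto
  finally show ?thesis .
qed

section \<open>The secular equation and its root\<close>

lemma secular_root_stationary_point:
  fixes \<mu> \<beta> :: "real^'n"
  assumes "secular_root p \<sigma> \<mu> \<beta> z"
  obtains y where "norm y = z" "\<And>i. (\<mu> $ i + \<sigma> * z powr (p - 2)) * y $ i = - \<beta> $ i"
proof -
  let ?m = "\<lambda>i. \<mu> $ i + \<sigma> * z powr (p - 2)"
  let ?s = "\<Sum>i\<in>UNIV. (\<beta> $ i)\<^sup>2 / (?m i)\<^sup>2"
  have z: "0 \<le> z" and eq: "secular_eq p \<sigma> \<mu> \<beta> z"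
    using assms by (auto simp: secular_root_def)
  show thesis
  proof (cases "\<forall>i. ?m i \<noteq> 0")
    case True
    define y :: "real^'n" where "y = (\<chi> i. - \<beta> $ i / ?m i)"
    have "(norm y)\<^sup>2 = z\<^sup>2"
      using eq True by (simp add: secular_eq_def norm_vec_sq y_def power_divide)
    then have "norm y = z" using z by (simp add: power2_eq_iff_nonneg)
    then show thesis using True by (intro that[of y]) (simp_all add: y_def)
  next
    case False
    then obtain k where k: "?m k = 0" by blast
    have \<beta>: "\<beta> $ i = 0" if "?m i = 0" for i
      using eq that by (auto simp: secular_eq_def split: if_splits)
    have s: "?s \<le> z\<^sup>2"
      using eq k by (auto simp: secular_eq_def split: if_splits)
    \<comment> \<open>Coordinate \<open>k\<close> is free because its coefficient is 0, so it
      absorbs the deficit \<open>z\<^sup>2 - ?s\<close>. Since division by 0 gives 0,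
      \<open>k\<close> adds nothing to \<open>?s\<close>, and any other degenerate coordinate of
      \<open>y\<close> is 0.\<close>
    define y :: "real^'n" where
      "y = (\<chi> i. if i = k then sqrt (z\<^sup>2 - ?s) else - \<beta> $ i / ?m i)"
    have "(y $ i)\<^sup>2 = (\<beta> $ i)\<^sup>2 / (?m i)\<^sup>2 + (if i = k then z\<^sup>2 - ?s else 0)" for i
      using k s by (simp add: y_def power_divide)
    then have "(norm y)\<^sup>2 = z\<^sup>2" by (simp add: norm_vec_sq sum.distrib)
    then have "norm y = z" using z by (simp add: power2_eq_iff_nonneg)
    moreover have "?m i * y $ i = - \<beta> $ i" for i
      using k \<beta>[of i] by (cases "?m i = 0") (auto simp: y_def)
    ultimately show thesis using that by blast
  qed
qed

lemma diag_minimizer_iff_root: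
  fixes \<mu> \<beta> :: "real^'n"
  assumes p: "2 < p" "0 < \<sigma>" and z: "secular_root p \<sigma> \<mu> \<beta> z"
  shows "global_minimizer (diag_obj p \<sigma> \<mu> \<beta>) x \<longleftrightarrow>
    (\<forall>i. (\<mu> $ i + \<sigma> * z powr (p - 2)) * x $ i = - \<beta> $ i) \<and> norm x = z"
proof -
  obtain y where y: "norm y = z" "\<And>i. (\<mu> $ i + \<sigma> * z powr (p - 2)) * y $ i = - \<beta> $ i"
    using secular_root_stationary_point[OF z] by blast
  then show ?thesis
    using diag_minimizer_iff[OF p _ y(2)] z by (simp add: secular_root_def)
qed

text \<open>Without vanishing denominators the linear system determines \<open>x\<close>, and the
  secular equation says precisely that its squared norm is z^2.\<close>

lemma secular_root_nondegenerate_norm: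
  fixes x :: "real^'n"
  assumes z: "secular_root p \<sigma> \<mu> \<beta> z" and nz: "\<forall>i. \<mu> $ i + \<sigma> * z powr (p - 2) \<noteq> 0"
    and x: "\<And>i. (\<mu> $ i + \<sigma> * z powr (p - 2)) * x $ i = - \<beta> $ i"
  shows "norm x = z"
proof -
  have "x $ i = - \<beta> $ i / (\<mu> $ i + \<sigma> * z powr (p - 2))" for i
    using x[of i] nz by (simp add: field_simps)
  then have "(norm x)\<^sup>2 = z\<^sup>2"
    using z nz by (simp add: norm_vec_sq secular_root_def secular_eq_def power_divide)
  then show ?thesis using z by (simp add: power2_eq_iff_nonneg secular_root_def)
qed

lemma secular_root_unique:
  assumes p: "2 < p" "0 < \<sigma>"
    and z: "secular_root p \<sigma> \<mu> \<beta> z" "secular_root p \<sigma> \<mu> \<beta> z'"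
  shows "z = z'"
proof -
  obtain y where "norm y = z" "\<And>i. (\<mu> $ i + \<sigma> * z powr (p - 2)) * y $ i = - \<beta> $ i"
    using secular_root_stationary_point[OF z(1)] by blast
  then have "global_minimizer (diag_obj p \<sigma> \<mu> \<beta>) y"
    using diag_minimizer_iff_root[OF p z(1)] by blast
  then show ?thesis
    using diag_minimizer_iff_root[OF p z(1), of y] diag_minimizer_iff_root[OF p z(2), of y] by simp
qed

text \<open>To the right of \<open>a\<close> the secular sum is continuous and non-increasing, since
  \<beta>_i vanishes wherever the denominator does at \<open>a\<close>. It starts at or above a^2
  while z^2 grows without bound, so the two cross.\<close>

lemma secular_root_above:
  fixes \<mu> \<beta> :: "real^'n"
  assumes p: "2 < p" "0 < \<sigma>" and a: "0 \<le> a"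
    and m: "\<And>i. 0 \<le> \<mu> $ i + \<sigma> * a powr (p - 2)"
    and deg: "\<And>i. \<mu> $ i + \<sigma> * a powr (p - 2) = 0 \<Longrightarrow> \<beta> $ i = 0"
    and ge: "a\<^sup>2 \<le> (\<Sum>i\<in>UNIV. (\<beta> $ i)\<^sup>2 / (\<mu> $ i + \<sigma> * a powr (p - 2))\<^sup>2)"
  shows "\<exists>z. secular_root p \<sigma> \<mu> \<beta> z"
proof -
  let ?m = "\<lambda>i z. \<mu> $ i + \<sigma> * z powr (p - 2)"
  define f where "f z = (\<Sum>i\<in>UNIV. (\<beta> $ i)\<^sup>2 / (?m i z)\<^sup>2)" for z
  have mono: "?m i a \<le> ?m i z" if "a \<le> z" for i z
    using p a that by (simp add: powr_mono2)
  have le: "f z \<le> f a" if "a \<le> z" for z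
    unfolding f_def
  proof (rule sum_mono)
    fix i
    show "(\<beta> $ i)\<^sup>2 / (?m i z)\<^sup>2 \<le> (\<beta> $ i)\<^sup>2 / (?m i a)\<^sup>2"
    proof (cases "\<beta> $ i = 0")
      case False
      then have "0 < ?m i a" using m[of i] deg[of i] by fastforce
      then show ?thesis using mono[OF that, of i]
        by (intro divide_left_mono power_mono mult_pos_pos zero_less_power) auto
    qed simp
  qed
  have cont: "continuous_on {a..b} f" for b
    unfolding f_def
  proof (rule continuous_on_sum)
    fix i
    show "continuous_on {a..b} (\<lambda>z. (\<beta> $ i)\<^sup>2 / (?m i z)\<^sup>2)"
    proof (cases "\<beta> $ i = 0")
      case False
      then have "0 < ?m i a" using m[of i] deg[of i] by fastforce
      then have "?m i z \<noteq> 0" if "z \<in> {a..b}" for z using mono[of z i] that by auto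
      then show ?thesis using a p
        by (intro continuous_intros continuous_on_powr') auto
    qed simp
  qed
  \<comment> \<open>Chosen so that \<open>f b \<le> f a \<le> b \<le> b\<^sup>2\<close>; the last
    inequality uses \<open>1 \<le> b\<close>.\<close>
  define b where "b = a + 1 + f a"
  have "0 \<le> f a" unfolding f_def by (intro sum_nonneg) simp
  then have b: "1 \<le> b" "a \<le> b" "f a \<le> b" using a by (auto simp: b_def)
  have "f b \<le> b\<^sup>2"
    using le[OF b(2)] b self_le_power[of b 2] by simp
  moreover have "a\<^sup>2 \<le> f a" using ge by (simp add: f_def)
  moreover have "continuous_on {a..b} (\<lambda>z. z\<^sup>2 - f z)" using cont by (intro continuous_intros)
  ultimately obtain z where z: "a \<le> z" "z \<le> b" "z\<^sup>2 - f z = 0"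
    using IVT'[of "\<lambda>z. z\<^sup>2 - f z" a 0 b] b by auto
  have nonneg: "0 \<le> ?m i z" for i using m[of i] mono[OF z(1), of i] by simp
  \<comment> \<open>By monotonicity a denominator vanishing at \<open>z\<close> already vanishes at
    \<open>a\<close>. Thus both branches of \<open>secular_eq\<close> are covered.\<close>
  have "\<beta> $ i = 0" if "?m i z = 0" for i
    using that deg[of i] m[of i] mono[OF z(1), of i] by simp
  then have "secular_eq p \<sigma> \<mu> \<beta> z" using z(3) by (auto simp: secular_eq_def f_def)
  then show ?thesis unfolding secular_root_def using nonneg z(1) a by (intro exI[of _ z]) auto
qed

lemma secular_root_exists:
  fixes \<mu> \<beta> :: "real^'n"
  assumes p: "2 < p" "0 < \<sigma>"
  shows "\<exists>z. secular_root p \<sigma> \<mu> \<beta> z"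
proof -
  let ?m = "\<lambda>i z. \<mu> $ i + \<sigma> * z powr (p - 2)"
  let ?f = "\<lambda>z. \<Sum>i\<in>UNIV. (\<beta> $ i)\<^sup>2 / (?m i z)\<^sup>2"
  define l where "l = Min (range (($) \<mu>))"
  have l: "l \<le> \<mu> $ i" for i by (simp add: l_def)
  have "l \<in> range (($) \<mu>)" unfolding l_def by (rule Min_in) auto
  then obtain k where k: "\<mu> $ k = l" by auto
  \<comment> \<open>The left end of the admissible range: the least non-negative \<open>z\<close> at
    which all the \<open>?m i z\<close> are non-negative.\<close>
  define z0 where "z0 = (max 0 (- l) / \<sigma>) powr (1 / (p - 2))"
  have z0: "0 \<le> z0" by (simp add: z0_def)
  have "z0 powr (p - 2) = max 0 (- l) / \<sigma>"
    using p by (simp add: z0_def powr_powr)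
  then have w0: "\<sigma> * z0 powr (p - 2) = max 0 (- l)" using p by simp
  have nonneg: "0 \<le> ?m i z0" for i using l[of i] w0 by simp
  show ?thesis
  proof (cases "\<forall>i. ?m i z0 = 0 \<longrightarrow> \<beta> $ i = 0")
    case True
    show ?thesis
    proof (cases "z0\<^sup>2 \<le> ?f z0")
      case ge: True
      show ?thesis using secular_root_above[OF p z0 nonneg _ ge] True by blast
    next
      case False
      \<comment> \<open>The hard case: the sum at \<open>z0\<close> is finite but below z0^2. Then
        \<open>z0\<close> is positive, so the smallest coefficient vanishes there, and
        \<open>z0\<close> itself is a root through the inequality branch of
        \<open>secular_eq\<close>.\<close>
      have "0 \<le> ?f z0" by (intro sum_nonneg) simp
      then have "z0 \<noteq> 0" using False by auto
      then have "0 < - l" by (auto simp: z0_def max_def split: if_splits)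
      then have "?m k z0 = 0" using k w0 by simp
      then have "secular_eq p \<sigma> \<mu> \<beta> z0" using True False by (auto simp: secular_eq_def)
      then show ?thesis using z0 nonneg by (auto simp: secular_root_def)
    qed
  next
    case False
    then obtain i where i: "?m i z0 = 0" "\<beta> $ i \<noteq> 0" by blast
    \<comment> \<open>The \<open>i\<close>-th summand blows up at \<open>z0\<close>. Clearing its
      denominator gives \<open>?h\<close>, continuous with value 0 at \<open>z0\<close>; so slightly
      to the right this summand alone exceeds z^2, and the crossing argument can start
      there.\<close>
    let ?h = "\<lambda>z. z\<^sup>2 * (?m i z)\<^sup>2"
    have "continuous_on {0..} ?h" using p by (intro continuous_intros continuous_on_powr') auto
    then have "(?h \<longlongrightarrow> ?h z0) (at z0 within {0..})" using z0 by (auto simp: continuous_on_def)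
    then have "(?h \<longlongrightarrow> 0) (at_right z0)"
      using i z0 by (auto intro: tendsto_within_subset)
    then have "\<forall>\<^sub>F z in at_right z0. ?h z < (\<beta> $ i)\<^sup>2"
      by (rule order_tendstoD) (use i in simp)
    then have "\<forall>\<^sub>F z in at_right z0. ?h z < (\<beta> $ i)\<^sup>2 \<and> z0 < z"
      using eventually_at_right_less by (rule eventually_conj)
    then obtain z where z: "?h z < (\<beta> $ i)\<^sup>2" "z0 < z"
      using eventually_happens'[OF trivial_limit_at_right_real] by blast
    have "z0 powr (p - 2) < z powr (p - 2)" using p z z0 by (simp add: powr_less_mono2)
    then have pos: "0 < ?m j z" for j
      using nonneg[of j] mult_strict_left_mono[OF _ p(2)] by fastforce
    have "z\<^sup>2 \<le> (\<beta> $ i)\<^sup>2 / (?m i z)\<^sup>2" using z pos[of i] by (simp add: field_simps)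
    also have "\<dots> \<le> ?f z" by (rule member_le_sum) auto
    finally show ?thesis
      using z z0 pos by (intro secular_root_above[OF p, of z]) (auto simp: less_imp_le less_le)
  qed
qed

section \<open>Reduction to the diagonal problem\<close>

lemma diag_mat_mult_vec: "(diag_mat d *v y) $ i = d $ i * y $ i"
  by (simp add: diag_mat_def matrix_vector_mult_def if_distrib[of "\<lambda>a. a * _"] cong: if_cong)

lemma diag_mat_form: "y \<bullet> (diag_mat d *v y) = (\<Sum>i\<in>UNIV. d $ i * (y $ i)\<^sup>2)"
  by (simp add: inner_vec_def diag_mat_mult_vec power2_eq_square mult.assoc mult.left_commute)

lemma diag_form_nonneg_iff:
  fixes d :: "real^'n"
  shows "(\<forall>y. 0 \<le> y \<bullet> (diag_mat d *v y)) \<longleftrightarrow> (\<forall>i. 0 \<le> d $ i)"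
proof
  assume *: "\<forall>y. 0 \<le> y \<bullet> (diag_mat d *v y)"
  show "\<forall>i. 0 \<le> d $ i"
  proof
    fix i
    have "axis i 1 \<bullet> (diag_mat d *v axis i 1) = d $ i"
      by (simp add: inner_axis' diag_mat_mult_vec)
    then show "0 \<le> d $ i" using * by metis
  qed
qed (simp add: diag_mat_form sum_nonneg)

text \<open>The change of variables y = P x. The right inverse \<open>Q\<close> makes
  \<open>P\<close> onto, so \<open>y\<close> ranges over all vectors, and makes
  \<open>transpose P\<close> injective, so equations can be cancelled through it.\<close>

locale congruent_diagonal =
  fixes P Q H A :: "real^'n^'n" and c \<mu> \<beta> :: "real^'n"
  assumes PQ: "P ** Q = mat 1"
    and A: "A = transpose P ** P"
    and H: "H = transpose P ** diag_mat \<mu> ** P"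
    and c: "c = transpose P *v \<beta>"
begin

lemma P_Q: "P *v (Q *v y) = y"
  by (simp add: matrix_vector_mul_assoc PQ)

lemma inner_transpose: "x \<bullet> (transpose P *v y) = (P *v x) \<bullet> y"
  by (metis dot_lmul_matrix inner_commute transpose_matrix_vector)

lemma norm_wrt_eq: "norm_wrt A x = norm (P *v x)"
  unfolding norm_wrt_def A norm_eq_sqrt_inner matrix_vector_mul_assoc[symmetric] inner_transpose ..

lemma preg_obj_eq: "preg_obj p \<sigma> c H A x = diag_obj p \<sigma> \<mu> \<beta> (P *v x)"
proof -
  have "c \<bullet> x = \<beta> \<bullet> (P *v x)" by (metis c inner_commute inner_transpose)
  moreover have "x \<bullet> (H *v x) = (P *v x) \<bullet> (diag_mat \<mu> *v (P *v x))"
    unfolding H matrix_vector_mul_assoc[symmetric] inner_transpose ..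
  ultimately show ?thesis by (simp add: preg_obj_def diag_obj_def norm_wrt_eq diag_mat_form)
qed

lemma global_minimizer_iff:
  "global_minimizer (preg_obj p \<sigma> c H A) x \<longleftrightarrow> global_minimizer (diag_obj p \<sigma> \<mu> \<beta>) (P *v x)"
  unfolding global_minimizer_def preg_obj_eq by (metis P_Q)

text \<open>The congruence by \<open>P\<close> that takes diag(\<mu>) to \<open>H\<close> takes the
  identity to \<open>A\<close>, so adding a multiple of \<open>A\<close> shifts every diagonal entry
  equally.\<close>

lemma shifted_eq: "H + w *\<^sub>R A = transpose P ** diag_mat (\<chi> i. \<mu> $ i + w) ** P"
proof -
  have "diag_mat (\<chi> i. \<mu> $ i + w) = diag_mat \<mu> + w *\<^sub>R mat 1"
    by (simp add: diag_mat_def mat_def vec_eq_iff)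
  then have D: "diag_mat (\<chi> i. \<mu> $ i + w) *v y = diag_mat \<mu> *v y + w *\<^sub>R y" for y
    by (simp add: matrix_vector_mult_add_rdistrib scaleR_matrix_vector_assoc[symmetric])
  show ?thesis
    unfolding matrix_eq H A
    by (simp only: matrix_vector_mult_add_rdistrib scaleR_matrix_vector_assoc[symmetric]
        matrix_vector_mul_assoc[symmetric] D matrix_vector_right_distrib matrix_vector_mult_scaleR) simp
qed

lemma shifted_solution_iff:
  "(H + w *\<^sub>R A) *v x = - c \<longleftrightarrow> (\<forall>i. (\<mu> $ i + w) * (P *v x) $ i = - \<beta> $ i)"
proof -
  have inj: "transpose P *v u = transpose P *v v \<longleftrightarrow> u = v" for u v
  proof -
    have "transpose Q ** transpose P = mat 1"
      by (metis PQ matrix_transpose_mul transpose_mat)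
    then show ?thesis by (metis matrix_vector_mul_assoc matrix_vector_mul_lid)
  qed
  have "(H + w *\<^sub>R A) *v x = transpose P *v (diag_mat (\<chi> i. \<mu> $ i + w) *v (P *v x))"
    unfolding shifted_eq by (simp add: matrix_vector_mul_assoc matrix_mul_assoc)
  moreover have "- c = transpose P *v (- \<beta>)"
    by (simp add: c vector_matrix_mult_def matrix_vector_mult_def vec_eq_iff sum_negf)
  ultimately have "(H + w *\<^sub>R A) *v x = - c \<longleftrightarrow> diag_mat (\<chi> i. \<mu> $ i + w) *v (P *v x) = - \<beta>"
    by (simp only: inj)
  then show ?thesis by (simp add: vec_eq_iff[of _ "- \<beta>"] diag_mat_mult_vec)
qed

lemma shifted_psd_iff: "pos_semidef (H + w *\<^sub>R A) \<longleftrightarrow> (\<forall>i. 0 \<le> \<mu> $ i + w)"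
proof -
  let ?D = "diag_mat (\<chi> i. \<mu> $ i + w)"
  have "transpose ?D = ?D" by (auto simp: diag_mat_def transpose_def vec_eq_iff)
  then have "transpose (H + w *\<^sub>R A) = H + w *\<^sub>R A"
    unfolding shifted_eq by (simp add: matrix_transpose_mul matrix_mul_assoc)
  moreover have "x \<bullet> ((H + w *\<^sub>R A) *v x) = (P *v x) \<bullet> (?D *v (P *v x))" for x
    unfolding shifted_eq matrix_vector_mul_assoc[symmetric] inner_transpose ..
  then have "(\<forall>x. 0 \<le> x \<bullet> ((H + w *\<^sub>R A) *v x)) \<longleftrightarrow> (\<forall>y. 0 \<le> y \<bullet> (?D *v y))"
    by (metis P_Q)
  ultimately show ?thesis by (simp add: pos_semidef_def diag_form_nonneg_iff)
qed

end

text \<open>The norm condition is demanded only when some \<mu>_i + \<sigma> z^(p-2) vanishes: the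
  linear system is then singular and has solutions of other norms too. Otherwise the system forces
  the norm to be \<open>z\<close>.\<close>

theorem theorem2p2:
  fixes p \<sigma> :: real
    and c \<mu> \<beta> :: "(real, 'n::{finite,linorder}) vec"
    and H A V :: "((real, 'n) vec, 'n) vec"
  assumes "2 < p" and "0 < \<sigma>"
    and "transpose H = H"
    and "pos_def A"
    and "\<forall>i j. i \<le> j \<longrightarrow> \<mu> $ i \<le> \<mu> $ j"
    and "orthogonal_matrix V"
    and "transpose V ** (matrix_inv (mat_sqrt A) ** H ** matrix_inv (mat_sqrt A)) ** V = diag_mat \<mu>"
    and "\<beta> = transpose V *v (matrix_inv (mat_sqrt A) *v c)"
  shows "(\<exists>!z. secular_root p \<sigma> \<mu> \<beta> z) \<and>
    (\<forall>z. secular_root p \<sigma> \<mu> \<beta> z \<longrightarrow>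
      (\<forall>x. global_minimizer (preg_obj p \<sigma> c H A) x \<longleftrightarrow>
         (H + (\<sigma> * z powr (p - 2)) *\<^sub>R A) *v x = - c \<and>
         pos_semidef (H + (\<sigma> * z powr (p - 2)) *\<^sub>R A) \<and>
         ((\<exists>i. \<mu> $ i + \<sigma> * z powr (p - 2) = 0) \<longrightarrow> norm_wrt A x = z))) \<and>
    (\<forall>x y. global_minimizer (preg_obj p \<sigma> c H A) x \<longrightarrow>
         global_minimizer (preg_obj p \<sigma> c H A) y \<longrightarrow> norm_wrt A x = norm_wrt A y)"
proof -
  note p = assms(1,2)
  define S R where "S = mat_sqrt A" and "R = matrix_inv S"
  have S: "pos_def S" and SS: "S ** S = A" and St: "transpose S = S"
    using mat_sqrt[OF assms(4)] by (auto simp: S_def pos_def_def)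
  have SR: "S ** R = mat 1" and RS: "R ** S = mat 1"
    using someI_ex[OF invertible_pos_def[OF S, unfolded invertible_def]]
    by (simp_all add: R_def matrix_inv_def)
  have V: "V ** transpose V = mat 1" "transpose V ** V = mat 1"
    using assms(6) by (auto simp: orthogonal_matrix_def)
  have SRX: "S ** (R ** X) = X"
    and VX: "V ** (transpose V ** X) = X" "transpose V ** (V ** X) = X"
    for X :: "((real, 'n) vec, 'n) vec"
    by (simp_all add: matrix_mul_assoc SR RS V)
  \<comment> \<open>Here \<open>S\<close> is the square root of \<open>A\<close> and
    \<open>R\<close> its inverse. Solving the diagonalization for \<open>H\<close> and the
    definition of \<beta> for \<open>c\<close> cancels \<open>R\<close> against \<open>S\<close> and
    \<open>V\<close> against its transpose.\<close>
  interpret congruent_diagonal "transpose V ** S" "R ** V" H A c \<mu> \<beta>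
  proof
    have D: "diag_mat \<mu> = transpose V ** (R ** H ** R) ** V" using assms(7) by (simp add: R_def S_def)
    show "H = transpose (transpose V ** S) ** diag_mat \<mu> ** (transpose V ** S)"
      by (simp add: D matrix_transpose_mul St matrix_mul_assoc[symmetric] SRX VX RS)
    have "transpose (transpose V ** S) ** (transpose V ** R) = mat 1"
      by (simp add: matrix_transpose_mul St matrix_mul_assoc[symmetric] VX SR)
    then show "c = transpose (transpose V ** S) *v \<beta>"
      unfolding assms(8) R_def[symmetric] S_def[symmetric] matrix_vector_mul_assoc
      by (simp add: matrix_mul_assoc)
  qed (simp_all add: matrix_transpose_mul St matrix_mul_assoc[symmetric] SRX VX V RS SS)
  have min_iff: "global_minimizer (preg_obj p \<sigma> c H A) x \<longleftrightarrow>
      (H + (\<sigma> * z powr (p - 2)) *\<^sub>R A) *v x = - c \<and> norm_wrt A x = z"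
    if "secular_root p \<sigma> \<mu> \<beta> z" for x z
    by (simp add: global_minimizer_iff diag_minimizer_iff_root[OF p that] shifted_solution_iff
        norm_wrt_eq)
  have psd: "pos_semidef (H + (\<sigma> * z powr (p - 2)) *\<^sub>R A)" if "secular_root p \<sigma> \<mu> \<beta> z" for z
    using that by (simp add: shifted_psd_iff secular_root_def)
  have nondeg: "norm_wrt A x = z"
    if "secular_root p \<sigma> \<mu> \<beta> z" "\<not> (\<exists>i. \<mu> $ i + \<sigma> * z powr (p - 2) = 0)"
      "(H + (\<sigma> * z powr (p - 2)) *\<^sub>R A) *v x = - c" for x z
    using secular_root_nondegenerate_norm[OF that(1)] that(2,3)
    by (simp add: norm_wrt_eq shifted_solution_iff)
  obtain z where z: "secular_root p \<sigma> \<mu> \<beta> z" using secular_root_exists[OF p] by blast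
  show ?thesis
  proof (intro conjI)
    show "\<exists>!z. secular_root p \<sigma> \<mu> \<beta> z" using z secular_root_unique[OF p] by blast
  next
    show "\<forall>z. secular_root p \<sigma> \<mu> \<beta> z \<longrightarrow>
      (\<forall>x. global_minimizer (preg_obj p \<sigma> c H A) x \<longleftrightarrow>
         (H + (\<sigma> * z powr (p - 2)) *\<^sub>R A) *v x = - c \<and>
         pos_semidef (H + (\<sigma> * z powr (p - 2)) *\<^sub>R A) \<and>
         ((\<exists>i. \<mu> $ i + \<sigma> * z powr (p - 2) = 0) \<longrightarrow> norm_wrt A x = z))"
      using min_iff psd nondeg by blast
  next
    show "\<forall>x y. global_minimizer (preg_obj p \<sigma> c H A) x \<longrightarrow>
         global_minimizer (preg_obj p \<sigma> c H A) y \<longrightarrow> norm_wrt A x = norm_wrt A y"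
      by (simp add: min_iff[OF z])
  qed
qed

end
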